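(* Let $t,s$ be integers with $4 \leq t \leq s \leq \frac{13t+37}{2}$ and let $G=C_3^tC_4^s$. Then $G$ is graceful when $t\equiv 0,1\pmod 4$ and near graceful when $t\equiv 2,3\pmod 4$.
   Context: $C_n^t$ denotes the union of $t$ cycles of length $n$ sharing exactly one common (central) vertex, and $C_3^tC_4^s$ denotes the graph obtained by identifying the central vertices of $C_3^t$ and $C_4^s$. For a graph $G$ with $m$ edges, a graceful labelling is an injective map $f:V(G)\to\{0,\ldots,m\}$ such that $g(uv)=|f(u)-f(v)|$ is a bijection $E(G)\to\{1,\ldots,m\}$. A near graceful labelling is an injective map $f:V(G)\to\{0,\ldots,m+1\}$ such that $g(uv)=|f(u)-f(v)|$ is a bijection onto $\{1,\ldots,m-1,m\}$ or onto $\{1,\ldots,m-1,m+1\}$. A graph is (near) graceful if it admits such a labelling. *)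

theory Defs
  imports Complex_Main
begin

text \<open>A simple undirected graph is a pair of a vertex set and a set of two-element edges.\<close>

type_synonym 'a graph = "'a set \<times> 'a set set"

abbreviation verts :: "'a graph \<Rightarrow> 'a set" where
  "verts G \<equiv> fst G"

abbreviation edges :: "'a graph \<Rightarrow> 'a set set" where
  "edges G \<equiv> snd G"

definition simple_graph :: "'a graph \<Rightarrow> bool" where
  "simple_graph G \<longleftrightarrow> finite (verts G) \<and> (\<forall>e\<in>edges G. e \<subseteq> verts G \<and> card e = 2)"

definition map_graph :: "('a \<Rightarrow> 'b) \<Rightarrow> 'a graph \<Rightarrow> 'b graph" where
  "map_graph h G = (h ` verts G, (`) h ` edges G)"

definition graph_union :: "'a graph \<Rightarrow> 'a graph \<Rightarrow> 'a graph" where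
  "graph_union G H = (verts G \<union> verts H, edges G \<union> edges H)"

text \<open>The cycle of length \<open>n\<close> (a simple graph with \<open>n\<close> edges for \<open>n \<ge> 3\<close>).\<close>

definition cycle_graph :: "nat \<Rightarrow> nat graph" where
  "cycle_graph n = ({..<n}, (\<lambda>j. {j, Suc j mod n}) ` {..<n})"

text \<open>\<open>cycle_bouquet n t\<close> is the graph $C_n^t$: the \<open>i\<close>-th cycle has vertex \<open>0\<close> renamed to
  \<open>Center\<close> and every other vertex \<open>j\<close> renamed to \<open>Rim i j\<close>.\<close>

datatype bouquet_vertex = Center | Rim nat nat

definition bouquet_vertex_of :: "nat \<Rightarrow> nat \<Rightarrow> bouquet_vertex" where
  "bouquet_vertex_of i j = (if j = 0 then Center else Rim i j)"

definition cycle_bouquet :: "nat \<Rightarrow> nat \<Rightarrow> bouquet_vertex graph" where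
  "cycle_bouquet n t =
     ({Center} \<union> (\<Union>i<t. verts (map_graph (bouquet_vertex_of i) (cycle_graph n))),
      (\<Union>i<t. edges (map_graph (bouquet_vertex_of i) (cycle_graph n))))"

text \<open>The disjoint union of \<open>G\<close> and \<open>H\<close> with \<open>u\<close> in \<open>G\<close> and \<open>v\<close> in \<open>H\<close> identified;
  the identified vertex is represented by \<open>Inl u\<close>.\<close>

definition identify_vertices :: "'a graph \<Rightarrow> 'a \<Rightarrow> 'b graph \<Rightarrow> 'b \<Rightarrow> ('a + 'b) graph" where
  "identify_vertices G u H v =
     graph_union (map_graph Inl G) (map_graph (\<lambda>x. if x = v then Inl u else Inr x) H)"

definition C3C4_graph :: "nat \<Rightarrow> nat \<Rightarrow> (bouquet_vertex + bouquet_vertex) graph" where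
  "C3C4_graph t s = identify_vertices (cycle_bouquet 3 t) Center (cycle_bouquet 4 s) Center"

definition induced_edge_labelling :: "'a graph \<Rightarrow> ('a \<Rightarrow> int) \<Rightarrow> ('a set \<Rightarrow> int) \<Rightarrow> bool" where
  "induced_edge_labelling G f g \<longleftrightarrow> (\<forall>u v. {u, v} \<in> edges G \<longrightarrow> g {u, v} = \<bar>f u - f v\<bar>)"

definition graceful_labelling :: "'a graph \<Rightarrow> ('a \<Rightarrow> int) \<Rightarrow> bool" where
  "graceful_labelling G f \<longleftrightarrow>
     (let m = int (card (edges G)) in
        inj_on f (verts G) \<and> f ` verts G \<subseteq> {0..m} \<and>
        (\<exists>g. induced_edge_labelling G f g \<and> bij_betw g (edges G) {1..m}))"

definition near_graceful_labelling :: "'a graph \<Rightarrow> ('a \<Rightarrow> int) \<Rightarrow> bool" where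
  "near_graceful_labelling G f \<longleftrightarrow>
     (let m = int (card (edges G)) in
        inj_on f (verts G) \<and> f ` verts G \<subseteq> {0..m + 1} \<and>
        (\<exists>g. induced_edge_labelling G f g \<and>
             (bij_betw g (edges G) {1..m} \<or> bij_betw g (edges G) ({1..m - 1} \<union> {m + 1}))))"

definition graceful :: "'a graph \<Rightarrow> bool" where
  "graceful G \<longleftrightarrow> (\<exists>f. graceful_labelling G f)"

definition near_graceful :: "'a graph \<Rightarrow> bool" where
  "near_graceful G \<longleftrightarrow> (\<exists>f. near_graceful_labelling G f)"

lemma cycle_graph_3: "cycle_graph 3 = ({0,1,2}, {{0,1},{1,2},{2,0}})"
  by (simp add: cycle_graph_def lessThan_nat_numeral lessThan_Suc insert_commute flip: numeral_2_eq_2)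

lemma cycle_graph_4: "cycle_graph 4 = ({0,1,2,3}, {{0,1},{1,2},{2,3},{3,0}})"
  by (simp add: cycle_graph_def lessThan_nat_numeral lessThan_Suc insert_commute flip: numeral_2_eq_2)

lemma verts_C3C4_graph:
  "verts (C3C4_graph t s) =
     {Inl Center} \<union> (\<Union>i<t. {Inl (Rim i 1), Inl (Rim i 2)})
     \<union> (\<Union>i<s. {Inr (Rim i 1), Inr (Rim i 2), Inr (Rim i 3)})"
  by (simp add: C3C4_graph_def identify_vertices_def graph_union_def map_graph_def
      cycle_bouquet_def cycle_graph_3 cycle_graph_4 bouquet_vertex_of_def image_UN) blast

lemma edges_C3C4_graph:
  "edges (C3C4_graph t s) =
     (\<Union>i<t. {{Inl (Rim i 1), Inl Center}, {Inl (Rim i 1), Inl (Rim i 2)},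
              {Inl (Rim i 2), Inl Center}})
     \<union> (\<Union>i<s. {{Inr (Rim i 1), Inl Center}, {Inr (Rim i 1), Inr (Rim i 2)},
                {Inr (Rim i 2), Inr (Rim i 3)}, {Inr (Rim i 3), Inl Center}})"
  by (simp add: C3C4_graph_def identify_vertices_def graph_union_def map_graph_def
      cycle_bouquet_def cycle_graph_3 cycle_graph_4 bouquet_vertex_of_def image_UN insert_commute)

lemma simple_graph_C3C4_graph: "simple_graph (C3C4_graph t s)"
  by (simp add: simple_graph_def verts_C3C4_graph edges_C3C4_graph ball_Un)

lemma card_edges_C3C4_graph: "card (edges (C3C4_graph t s)) = 3 * t + 4 * s"
proof -
  define A :: "nat \<Rightarrow> (bouquet_vertex + bouquet_vertex) set set" where
    "A = (\<lambda>i. {{Inl (Rim i 1), Inl Center}, {Inl (Rim i 1), Inl (Rim i 2)},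
              {Inl (Rim i 2), Inl Center}})"
  define B :: "nat \<Rightarrow> (bouquet_vertex + bouquet_vertex) set set" where
    "B = (\<lambda>i. {{Inr (Rim i 1), Inl Center}, {Inr (Rim i 1), Inr (Rim i 2)},
              {Inr (Rim i 2), Inr (Rim i 3)}, {Inr (Rim i 3), Inl Center}})"
  have fin: "finite (A i)" "finite (B i)" for i
    by (simp_all add: A_def B_def)
  have card: "card (A i) = 3" "card (B i) = 4" for i
    by (simp_all add: A_def B_def doubleton_eq_iff)
  have A: "A i \<inter> A j = {}" "B i \<inter> B j = {}" if "i \<noteq> j" for i j
    using that by (simp_all add: A_def B_def doubleton_eq_iff)
  have AB: "A i \<inter> B j = {}" for i j
    by (simp add: A_def B_def doubleton_eq_iff)
  have "card (\<Union>i<t. A i) = 3 * t" "card (\<Union>i<s. B i) = 4 * s"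
    using fin A by (simp_all add: card_UN_disjoint card)
  moreover have "card ((\<Union>i<t. A i) \<union> (\<Union>i<s. B i)) = card (\<Union>i<t. A i) + card (\<Union>i<s. B i)"
    using fin AB by (intro card_Un_disjoint) blast+
  ultimately show ?thesis
    by (simp add: edges_C3C4_graph A_def B_def)
qed

end

theory Submission
  imports Defs
begin

text \<open>
  Give the central vertex the label \<open>0\<close> and let \<open>w = t + 4s\<close>. The triangles take the edge labels
  \<open>1..t\<close> and the \<open>2t\<close> labels above \<open>w\<close>: a Skolem sequence (hooked if \<open>t\<close> is \<open>2\<close> or \<open>3\<close> modulo \<open>4\<close>)
  splits the latter into pairs with differences \<open>1, \<dots>, t\<close>. The squares \<open>0, x, y, z\<close> take the
  labels \<open>t + 1..w\<close>. A block of \<open>r = 2k + 1\<close> squares uses the labels \<open>u + 1..u + 4r\<close>: the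
  upper half is adjacent to the centre, the lower half consists of the labels \<open>x - y\<close> and
  \<open>z - y\<close>, and the opposite vertices \<open>y\<close> fill the interval from \<open>2r - k\<close> to \<open>2r + k\<close>. If \<open>u\<close> is not too
  small and not too large compared with \<open>k\<close>, these \<open>y\<close> are not among the vertex labels used so
  far. Two blocks and at most one extra square give every required \<open>s\<close>.

  Since the number of edges is known, it suffices to show that each label occurs on an edge.
\<close>

section \<open>Skolem and hooked Skolem sequences\<close>

text \<open>Inclusions suffice: if \<open>P\<close> has \<open>2 * t\<close> elements, counting
  makes every difference and every entry occur exactly once. \<open>P\<close> is
  \<open>{1..2 * t}\<close> for a Skolem sequence and
  \<open>{1..2 * t - 1} \<union> {2 * t + 1}\<close> for a hooked one.\<close>

definition skolem_pairs :: "nat \<Rightarrow> nat set \<Rightarrow> (nat \<times> nat) list \<Rightarrow> bool" where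
  "skolem_pairs t P ps \<longleftrightarrow> length ps = t \<and> (\<forall>(a, b)\<in>set ps. 0 < a \<and> 0 < b) \<and>
     {1..t} \<subseteq> (\<lambda>(a, b). b - a) ` set ps \<and> P \<subseteq> fst ` set ps \<union> snd ` set ps"

text \<open>Concentric pairs are the building blocks of the sequences below: the differences fall
  from \<open>b - a\<close> in steps of 2, so one block supplies a run of differences of a single
  parity.\<close>

definition nested_pairs :: "nat \<Rightarrow> nat \<Rightarrow> nat \<Rightarrow> (nat \<times> nat) list" where
  "nested_pairs a b n = map (\<lambda>r. (a + r, b - r)) [0..<n]"

lemma length_nested_pairs [simp]: "length (nested_pairs a b n) = n"
  by (simp add: nested_pairs_def)

lemma fst_nested_pairs [simp]: "fst ` set (nested_pairs a b n) = {a..<a + n}"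
  by (simp add: nested_pairs_def image_image image_add_atLeastLessThan add.commute)

lemma snd_nested_pairs [simp]:
  assumes "n \<le> b + 1"
  shows "snd ` set (nested_pairs a b n) = {b + 1 - n..<b + 1}"
proof -
  have "v \<in> (\<lambda>r. b - r) ` {0..<n}" if "v \<in> {b + 1 - n..<b + 1}" for v
    by (rule image_eqI[of _ _ "b - v"]) (use that in auto)
  then show ?thesis using assms by (auto simp: nested_pairs_def image_image)
qed

text \<open>Pair number \<open>r\<close> has difference \<open>b - a - 2 * r\<close>. The assumption
  keeps even the innermost pair in increasing order, so the subtraction is never truncated.\<close>

lemma diff_nested_pairs [simp]:
  assumes "a + 2 * n \<le> b + 2"
  shows "d \<in> (\<lambda>(a, b). b - a) ` set (nested_pairs a b n) \<longleftrightarrow>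
    even (a + b + d) \<and> a + d \<le> b \<and> b < a + d + 2 * n"
proof
  assume d: "even (a + b + d) \<and> a + d \<le> b \<and> b < a + d + 2 * n"
  then have "even (b - (a + d))" by (auto simp: even_diff_nat)
  then obtain r where "b = a + d + 2 * r" using d by (metis evenE le_add_diff_inverse)
  with d show "d \<in> (\<lambda>(a, b). b - a) ` set (nested_pairs a b n)"
    by (auto simp: nested_pairs_def image_image intro!: image_eqI[of _ _ r])
qed (use assms in \<open>auto simp: nested_pairs_def\<close>)

lemma nested_pairs_pos:
  "(x, y) \<in> set (nested_pairs a b n) \<Longrightarrow> 0 < a \<Longrightarrow> n \<le> b \<Longrightarrow> 0 < x \<and> 0 < y"
  by (auto simp: nested_pairs_def)

text \<open>The general families below start at \<open>t = 8\<close> and \<open>t = 9\<close>, so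
  \<open>t = 4\<close> and \<open>t = 5\<close> get explicit sequences.\<close>

lemma skolem_pairs_4: "skolem_pairs 4 {1..8} [(1, 2), (4, 6), (5, 8), (3, 7)]"
  by (auto simp: skolem_pairs_def)

lemma skolem_pairs_5: "skolem_pairs 5 {1..10} [(1, 2), (4, 6), (7, 10), (5, 9), (3, 8)]"
  using [[linarith_neq_limit = 10]] by (auto simp: skolem_pairs_def)

text \<open>The first block gives all even differences and leaves only \<open>6 * p + 12\<close>
  free in the upper half. The other two blocks give the odd differences from
  \<open>2 * p + 7\<close> to \<open>4 * p + 5\<close> and from \<open>3\<close> to
  \<open>2 * p + 1\<close>; the single pairs give \<open>2 * p + 5\<close>, \<open>1\<close>,
  \<open>2 * p + 3\<close> and \<open>4 * p + 7\<close>.\<close>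

lemma skolem_pairs_mod_4_eq_0:
  "skolem_pairs (4 * p + 8) {1..8 * p + 16}
     (nested_pairs (4 * p + 8) (8 * p + 16) (2 * p + 4) @ nested_pairs 1 (4 * p + 6) p @
      nested_pairs (p + 4) (3 * p + 5) p @
      [(p + 1, 3 * p + 6), (p + 2, p + 3), (2 * p + 4, 4 * p + 7), (2 * p + 5, 6 * p + 12)])"
  unfolding skolem_pairs_def subset_iff
proof (intro conjI allI impI, goal_cases)
  case (3 d)
  then have d: "1 \<le> d" "d \<le> 4 * p + 8" by simp_all
  consider c where "d = 2 * c" | c where "d = 2 * c + 1" by (meson evenE oddE)
  then show ?case
  proof cases
    case (1 c)
    with 3 show ?thesis by (simp add: image_Un)
  next
    case (2 c)
    then consider "c = 0" | "1 \<le> c" "c \<le> p" | "c = p + 1" | "c = p + 2"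
      | "p + 3 \<le> c" "c \<le> 2 * p + 2" | "c = 2 * p + 3"
      using d by linarith
    then show ?thesis by cases (use 2 in \<open>simp_all add: image_Un\<close>)
  qed
next
  case (4 v)
  then show ?case by (simp add: image_Un) linarith
qed (auto dest: nested_pairs_pos)

text \<open>As before, the first block gives the even differences. The next two give the odd ones
  from \<open>2 * p + 5\<close> to \<open>4 * p + 7\<close> and from \<open>3\<close> to
  \<open>2 * p + 1\<close>; the single pairs give \<open>1\<close>, \<open>4 * p + 9\<close> and
  \<open>2 * p + 3\<close>.\<close>

lemma skolem_pairs_mod_4_eq_1:
  "skolem_pairs (4 * p + 9) {1..8 * p + 18}
     (nested_pairs (4 * p + 10) (8 * p + 18) (2 * p + 4) @ nested_pairs 1 (4 * p + 8) (p + 2) @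
      nested_pairs (p + 5) (3 * p + 6) p @
      [(p + 3, p + 4), (2 * p + 5, 6 * p + 14), (2 * p + 6, 4 * p + 9)])"
  unfolding skolem_pairs_def subset_iff
proof (intro conjI allI impI, goal_cases)
  case (3 d)
  then have d: "1 \<le> d" "d \<le> 4 * p + 9" by simp_all
  consider c where "d = 2 * c" | c where "d = 2 * c + 1" by (meson evenE oddE)
  then show ?case
  proof cases
    case (1 c)
    then have "1 \<le> c" "c \<le> 2 * p + 4" using d by linarith+
    then show ?thesis using 1 by (simp add: image_Un)
  next
    case (2 c)
    then consider "c = 0" | "1 \<le> c" "c \<le> p" | "c = p + 1"
      | "p + 2 \<le> c" "c \<le> 2 * p + 3" | "c = 2 * p + 4"
      using d by linarith
    then show ?thesis by cases (use 2 in \<open>simp_all add: image_Un\<close>)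
  qed
next
  case (4 v)
  then show ?case by (simp add: image_Un) linarith
qed (auto dest: nested_pairs_pos)

text \<open>Here the block of even differences, up to \<open>4 * p + 4\<close>, occupies the lower
  half and the odd blocks the upper half. The hook \<open>8 * p + 13\<close> is paired with
  \<open>4 * p + 7\<close>, which gives the largest difference \<open>t\<close>.\<close>

lemma hooked_skolem_pairs_mod_4_eq_2:
  "skolem_pairs (4 * p + 6) ({1..8 * p + 11} \<union> {8 * p + 13})
     (nested_pairs 1 (4 * p + 5) (2 * p + 2) @ nested_pairs (4 * p + 8) (8 * p + 11) p @
      nested_pairs (5 * p + 8) (7 * p + 9) p @
      [(2 * p + 3, 6 * p + 8), (4 * p + 6, 6 * p + 9), (4 * p + 7, 8 * p + 13), (7 * p + 10, 7 * p + 11)])"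
  unfolding skolem_pairs_def subset_iff
proof (intro conjI allI impI, goal_cases)
  case (3 d)
  then have d: "1 \<le> d" "d \<le> 4 * p + 6" by simp_all
  consider c where "d = 2 * c" | c where "d = 2 * c + 1" by (meson evenE oddE)
  then show ?case
  proof cases
    case (1 c)
    then consider "1 \<le> c" "c \<le> 2 * p + 2" | "c = 2 * p + 3"
      using d by linarith
    then show ?thesis by cases (use 1 in \<open>simp_all add: image_Un\<close>)
  next
    case (2 c)
    then consider "c = 0" | "1 \<le> c" "c \<le> p" | "c = p + 1"
      | "p + 2 \<le> c" "c \<le> 2 * p + 1" | "c = 2 * p + 2"
      using d by linarith
    then show ?thesis by cases (use 2 in \<open>simp_all add: image_Un\<close>)
  qed
next
  case (4 v)
  then show ?case by (simp add: image_Un) linarith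
qed (auto dest: nested_pairs_pos)

text \<open>The hook \<open>8 * p + 15\<close> is paired with \<open>4 * p + 8\<close> and gives the
  largest difference \<open>t\<close>. The even difference \<open>4 * p + 6\<close>, beyond the
  reach of the first block, comes from the pair that fills the gap \<open>6 * p + 11\<close> in the
  middle of that block.\<close>

lemma hooked_skolem_pairs_mod_4_eq_3:
  "skolem_pairs (4 * p + 7) ({1..8 * p + 13} \<union> {8 * p + 15})
     (nested_pairs (4 * p + 9) (8 * p + 13) (2 * p + 2) @ nested_pairs 1 (4 * p + 6) p @
      nested_pairs (p + 4) (3 * p + 5) p @
      [(p + 1, 3 * p + 6), (p + 2, p + 3), (2 * p + 4, 4 * p + 7), (2 * p + 5, 6 * p + 11),
       (4 * p + 8, 8 * p + 15)])"
  unfolding skolem_pairs_def subset_iff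
proof (intro conjI allI impI, goal_cases)
  case (3 d)
  then have d: "1 \<le> d" "d \<le> 4 * p + 7" by simp_all
  consider c where "d = 2 * c" | c where "d = 2 * c + 1" by (meson evenE oddE)
  then show ?case
  proof cases
    case (1 c)
    then consider "1 \<le> c" "c \<le> 2 * p + 2" | "c = 2 * p + 3"
      using d by linarith
    then show ?thesis by cases (use 1 in \<open>simp_all add: image_Un\<close>)
  next
    case (2 c)
    then consider "c = 0" | "1 \<le> c" "c \<le> p" | "c = p + 1" | "c = p + 2"
      | "p + 3 \<le> c" "c \<le> 2 * p + 2" | "c = 2 * p + 3"
      using d by linarith
    then show ?thesis by cases (use 2 in \<open>simp_all add: image_Un\<close>)
  qed
next
  case (4 v)
  then have v: "1 \<le> v" "v \<le> 8 * p + 13 \<or> v = 8 * p + 15" by auto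
  show ?case
  proof (cases "v \<le> 4 * p + 8")
    case True
    with v consider "1 \<le> v" "v \<le> p" | "v = p + 1" | "v = p + 2" | "v = p + 3"
      | "p + 4 \<le> v" "v \<le> 2 * p + 3" | "v = 2 * p + 4" | "v = 2 * p + 5"
      | "2 * p + 6 \<le> v" "v \<le> 3 * p + 5" | "v = 3 * p + 6"
      | "3 * p + 7 \<le> v" "v \<le> 4 * p + 6" | "v = 4 * p + 7" | "v = 4 * p + 8"
      by linarith
    then show ?thesis by cases (simp_all add: image_Un)
  next
    case False
    with v consider "4 * p + 9 \<le> v" "v \<le> 6 * p + 10" | "v = 6 * p + 11"
      | "6 * p + 12 \<le> v" "v \<le> 8 * p + 13" | "v = 8 * p + 15"
      by linarith
    then show ?thesis by cases (simp_all add: image_Un)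
  qed
qed (auto dest: nested_pairs_pos)

lemma ex_skolem_pairs:
  assumes "4 \<le> t" "t mod 4 = 0 \<or> t mod 4 = 1"
  shows "\<exists>ps. skolem_pairs t {1..2 * t} ps"
proof -
  define p where "p = t div 4 - 2"
  have "t = 4 \<or> t = 5 \<or> t = 4 * p + 8 \<or> t = 4 * p + 9"
    using assms unfolding p_def by presburger
  then consider "t = 4" | "t = 5" | "t = 4 * p + 8" | "t = 4 * p + 9" by blast
  then show ?thesis
  proof cases
    case 1
    then show ?thesis using skolem_pairs_4 by auto
  next
    case 2
    then show ?thesis using skolem_pairs_5 by auto
  next
    case 3
    then have "2 * t = 8 * p + 16" by simp
    then show ?thesis using skolem_pairs_mod_4_eq_0[of p] 3 by metis
  next
    case 4
    then have "2 * t = 8 * p + 18" by simp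
    then show ?thesis using skolem_pairs_mod_4_eq_1[of p] 4 by metis
  qed
qed

lemma ex_hooked_skolem_pairs:
  assumes "4 \<le> t" "t mod 4 = 2 \<or> t mod 4 = 3"
  shows "\<exists>ps. skolem_pairs t ({1..2 * t - 1} \<union> {2 * t + 1}) ps"
proof -
  define p where "p = t div 4 - 1"
  have "t = 4 * p + 6 \<or> t = 4 * p + 7"
    using assms unfolding p_def by presburger
  then consider "t = 4 * p + 6" | "t = 4 * p + 7" by blast
  then show ?thesis
  proof cases
    case 1
    then have "2 * t - 1 = 8 * p + 11" "2 * t + 1 = 8 * p + 13" by simp_all
    then show ?thesis using hooked_skolem_pairs_mod_4_eq_2[of p] 1 by metis
  next
    case 2
    then have "2 * t - 1 = 8 * p + 13" "2 * t + 1 = 8 * p + 15" by simp_all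
    then show ?thesis using hooked_skolem_pairs_mod_4_eq_3[of p] 2 by metis
  qed
qed

section \<open>Labels of the squares\<close>

text \<open>In a triple, \<open>x\<close> and \<open>z\<close> are the neighbours of the centre and
  \<open>y\<close> is the opposite vertex. The \<open>4 * length qs\<close> edges must cover an
  interval of that size, so the labels \<open>x\<close>, \<open>z\<close> are distinct by counting,
  while \<open>y\<close> needs explicit conditions. It may lie below \<open>u\<close>, since edge
  labels may reappear as vertex labels.\<close>

definition square_vanes :: "nat \<Rightarrow> (nat \<times> nat \<times> nat) list \<Rightarrow> bool" where
  "square_vanes u qs \<longleftrightarrow>
     distinct (map (\<lambda>(x, y, z). y) qs) \<and>
     (\<forall>(x, y, z)\<in>set qs. x \<in> {u<..u + 4 * length qs} \<and> z \<in> {u<..u + 4 * length qs} \<and>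
        y \<in> {0<..u + 4 * length qs}) \<and>
     (\<forall>(x, y, z)\<in>set qs. \<forall>(x', y', z')\<in>set qs. y \<noteq> x' \<and> y \<noteq> z') \<and>
     {u<..u + 4 * length qs} \<subseteq> (\<Union>(x, y, z)\<in>set qs. {x, z, x - y, z - y})"

lemma square_vanesD:
  assumes "square_vanes u qs" "(x, y, z) \<in> set qs"
  shows "u < x" "x \<le> u + 4 * length qs" "u < z" "z \<le> u + 4 * length qs"
    "0 < y" "y \<le> u + 4 * length qs"
  using assms by (auto simp: square_vanes_def)

lemma square_vanes_middle_neq:
  assumes "square_vanes u qs" "(x, y, z) \<in> set qs" "(x', y', z') \<in> set qs"
  shows "y \<noteq> x'" "y \<noteq> z'"
  using assms by (fastforce simp: square_vanes_def)+

text \<open>The two intervals of edge labels are adjacent. Opposite vertices of \<open>qs\<close>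
  lie below all \<open>x\<close>, \<open>z\<close> of \<open>rs\<close>, so only those of
  \<open>rs\<close> can cause a clash.\<close>

lemma square_vanes_append:
  assumes qs: "square_vanes u qs" and rs: "square_vanes (u + 4 * length qs) rs"
    and new: "\<And>x y z x' y' z'. (x, y, z) \<in> set rs \<Longrightarrow> (x', y', z') \<in> set qs \<Longrightarrow>
      y \<noteq> x' \<and> y \<noteq> y' \<and> y \<noteq> z'"
  shows "square_vanes u (qs @ rs)"
  unfolding square_vanes_def
proof (intro conjI, goal_cases)
  case 1
  have "set (map (\<lambda>(x, y, z). y) qs) \<inter> set (map (\<lambda>(x, y, z). y) rs) = {}"
    using new by fastforce
  then show ?case using qs rs by (simp add: square_vanes_def)
next
  case 2
  show ?case using square_vanesD[OF qs] square_vanesD[OF rs] by fastforce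
next
  case 3
  have "y \<noteq> x' \<and> y \<noteq> z'" if q: "(x, y, z) \<in> set qs \<union> set rs" "(x', y', z') \<in> set qs \<union> set rs"
    for x y z x' y' z'
  proof -
    have "y \<noteq> x' \<and> y \<noteq> z'" if "(x, y, z) \<in> set qs" "(x', y', z') \<in> set rs"
      using square_vanesD(6)[OF qs that(1)] square_vanesD(1,3)[OF rs that(2)] by linarith
    then show ?thesis
      using q square_vanes_middle_neq[OF qs] square_vanes_middle_neq[OF rs] new by (metis Un_iff)
  qed
  then show ?case by fastforce
next
  case 4
  have "{u<..u + 4 * length (qs @ rs)} =
      {u<..u + 4 * length qs} \<union> {u + 4 * length qs<..u + 4 * length qs + 4 * length rs}"
    by auto
  also have "\<dots> \<subseteq> (\<Union>(x, y, z)\<in>set (qs @ rs). {x, z, x - y, z - y})"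
    using qs rs unfolding square_vanes_def set_append UN_Un by blast
  finally show ?case .
qed

text \<open>The labels \<open>x\<close> and \<open>z\<close> run through the upper half of the
  interval. Moving \<open>y\<close> in steps of 2 makes \<open>x - y\<close> and
  \<open>z - y\<close> fall in steps of 1; switching the starting value after \<open>i = k\<close>
  makes the four resulting runs tile the lower half.\<close>

definition square_block :: "nat \<Rightarrow> nat \<Rightarrow> (nat \<times> nat \<times> nat) list" where
  "square_block u k = map (\<lambda>i.
     (u + 4 * k + 3 + i, (if i \<le> k then 3 * k + 2 + 2 * i else k + 1 + 2 * i),
      u + 6 * k + 4 + i)) [0..<2 * k + 1]"

lemma length_square_block [simp]: "length (square_block u k) = 2 * k + 1"
  by (simp add: square_block_def)

lemma square_block_middle_ge: "(x, y, z) \<in> set (square_block u k) \<Longrightarrow> 3 * k + 2 \<le> y"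
  by (auto simp: square_block_def split: if_splits)

text \<open>The largest \<open>y\<close> is \<open>5 * k + 2\<close> and the smallest
  \<open>x\<close> is \<open>u + 4 * k + 3\<close>; \<open>k \<le> u\<close> says that the former is
  smaller.\<close>

lemma square_vanes_block:
  assumes "k \<le> u"
  shows "square_vanes u (square_block u k)"
  unfolding square_vanes_def
proof (intro conjI, goal_cases)
  case 1
  \<comment> \<open>The two progressions of opposite vertices have different parity: that of
    \<open>k\<close> for \<open>i \<le> k\<close>, that of \<open>k + 1\<close> for
    \<open>i > k\<close>.\<close>
  show ?case
    by (auto simp: square_block_def distinct_map comp_def inj_on_def split: if_splits) presburger+
next
  case 4
  show ?case
  proof
    fix l
    assume l: "l \<in> {u<..u + 4 * length (square_block u k)}"
    define c where "c = l - u"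
    have "\<exists>i<2 * k + 1. l = u + 4 * k + 3 + i \<or> l = u + 6 * k + 4 + i \<or>
      i \<le> k \<and> (l = u + k + 1 - i \<or> l = u + 3 * k + 2 - i) \<or>
      k < i \<and> (l = u + 3 * k + 2 - i \<or> l = u + 5 * k + 3 - i)"
    proof -
      have c: "l = u + c" "1 \<le> c" "c \<le> 8 * k + 4" using l by (auto simp: c_def)
      \<comment> \<open>The runs \<open>z - y\<close> for \<open>i \<le> k\<close> and
        \<open>x - y\<close> for \<open>i > k\<close> share the formula
        \<open>u + 3 * k + 2 - i\<close>, so they form one range; the last two ranges are those of
        \<open>x\<close> and \<open>z\<close>.\<close>
      consider "c \<le> k + 1" | "k + 1 < c" "c \<le> 3 * k + 2" | "3 * k + 2 < c" "c \<le> 4 * k + 2"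
        | "4 * k + 2 < c" "c \<le> 6 * k + 3" | "6 * k + 3 < c" by linarith
      then show ?thesis
      proof cases
        case 1 then show ?thesis using c by (intro exI[of _ "k + 1 - c"]) auto
      next
        case 2 then show ?thesis using c by (intro exI[of _ "3 * k + 2 - c"]) auto
      next
        case 3 then show ?thesis using c by (intro exI[of _ "5 * k + 3 - c"]) auto
      next
        case 4 then show ?thesis using c by (intro exI[of _ "c - (4 * k + 3)"]) auto
      next
        case 5 then show ?thesis using c by (intro exI[of _ "c - (6 * k + 4)"]) auto
      qed
    qed
    then obtain i where i: "i < 2 * k + 1" "l = u + 4 * k + 3 + i \<or> l = u + 6 * k + 4 + i \<or>
      i \<le> k \<and> (l = u + k + 1 - i \<or> l = u + 3 * k + 2 - i) \<or>
      k < i \<and> (l = u + 3 * k + 2 - i \<or> l = u + 5 * k + 3 - i)" by blast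
    define y where "y = (if i \<le> k then 3 * k + 2 + 2 * i else k + 1 + 2 * i)"
    have "(u + 4 * k + 3 + i, y, u + 6 * k + 4 + i) \<in> set (square_block u k)"
      using i(1) by (auto simp: square_block_def y_def)
    moreover have "l \<in> {u + 4 * k + 3 + i, u + 6 * k + 4 + i, u + 4 * k + 3 + i - y, u + 6 * k + 4 + i - y}"
      using i by (auto simp: y_def)
    ultimately show "l \<in> (\<Union>(x, y, z)\<in>set (square_block u k). {x, z, x - y, z - y})"
      by blast
  qed
qed (use assms in \<open>auto simp: square_block_def\<close>)

text \<open>This is the extra square for adjusting the parity; its opposite vertex \<open>1\<close>
  is smaller than those of all blocks used.\<close>

lemma square_vanes_single: "square_vanes u [(u + 4, 1, u + 2)]"
  by (auto simp: square_vanes_def)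

lemma ex_square_vanes:
  assumes "4 \<le> t" "1 \<le> s" "2 * s \<le> 13 * t + 37"
  shows "\<exists>qs. length qs = s \<and> square_vanes t qs"
proof -
  have "\<exists>qs. (length qs = s \<or> length qs + 1 = s) \<and> square_vanes t qs \<and>
    (\<forall>(x, y, z)\<in>set qs. 1 < y)"
  proof (cases "s \<le> 2 * t + 2")
    case True
    \<comment> \<open>The largest odd number of squares not exceeding \<open>s\<close>; the case
      assumption is what makes \<open>k \<le> t\<close>.\<close>
    define k where "k = (s - 1) div 2"
    have "k \<le> t" "2 * k + 1 = s \<or> 2 * k + 1 + 1 = s"
      using True \<open>1 \<le> s\<close> unfolding k_def by linarith+
    then show ?thesis
      by (intro exI[of _ "square_block t k"])
        (auto dest: square_block_middle_ge intro: square_vanes_block)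
  next
    case False
    define K where "K = (s - 2) div 2"
    \<comment> \<open>This is the least \<open>j\<close> for which the second block satisfies
      \<open>k \<le> u\<close>, which amounts to \<open>K \<le> 9 * j + t + 4\<close>. A small
      \<open>j\<close> also keeps \<open>j \<le> t\<close>, as the first block requires.\<close>
    define j where "j = (K + 4 - t) div 9"
    define k where "k = K - j"
    define u where "u = t + 4 * (2 * j + 1)"
    have K: "t \<le> K" "2 * K + 2 = s \<or> 2 * K + 3 = s"
      using False unfolding K_def by linarith+
    have j: "9 * j + t \<le> K + 4" "K \<le> 9 * j + t + 4"
      using K(1) unfolding j_def by linarith+
    have jk: "j + k = K" using K(1) j(1) \<open>4 \<le> t\<close> unfolding k_def by linarith
    have "j \<le> t" using assms K(2) j(1) by linarith
    moreover have "k \<le> u" using j(2) jk by (simp add: u_def)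
    \<comment> \<open>All labels of the first block are at most \<open>u\<close>, so the opposite
      vertices of the second block, which start at \<open>3 * k + 2\<close>, avoid them.\<close>
    moreover have "u < 3 * k + 2" using \<open>4 \<le> t\<close> K(1) j(1) jk by (simp add: u_def)
    ultimately have "square_vanes t (square_block t j @ square_block u k)"
      using square_vanes_block[of j t] square_vanes_block[of k u]
      by (intro square_vanes_append)
        (fastforce simp: u_def dest: square_vanesD square_block_middle_ge)+
    then show ?thesis using K(2) jk
      by (intro exI[of _ "square_block t j @ square_block u k"])
        (auto dest: square_block_middle_ge)
  qed
  then obtain qs where qs: "length qs = s \<or> length qs + 1 = s" "square_vanes t qs"
    "\<forall>(x, y, z)\<in>set qs. 1 < y" by blast
  show ?thesis
  proof (cases "length qs = s")
    case False
    have "square_vanes t (qs @ [(t + 4 * length qs + 4, 1, t + 4 * length qs + 2)])"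
      using qs(2,3) square_vanesD[OF qs(2)] assms(1)
      by (intro square_vanes_append square_vanes_single) fastforce+
    then show ?thesis using qs(1) False by (intro exI conjI) auto
  qed (use qs in blast)
qed

section \<open>From lists of numbers to a labelling of the graph\<close>

text \<open>The value at \<open>Inr Center\<close> is a dummy: the identified centre is
  \<open>Inl Center\<close>.\<close>

definition vane_label :: "(nat \<times> nat) list \<Rightarrow> (nat \<times> nat \<times> nat) list \<Rightarrow>
    bouquet_vertex + bouquet_vertex \<Rightarrow> nat" where
  "vane_label ps qs v = (case v of
     Inl Center \<Rightarrow> 0
   | Inl (Rim i j) \<Rightarrow> (if j = 1 then fst (ps ! i) else snd (ps ! i))
   | Inr Center \<Rightarrow> 0
   | Inr (Rim i j) \<Rightarrow> (if j = 1 then fst (qs ! i) else if j = 2 then fst (snd (qs ! i))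
       else snd (snd (qs ! i))))"

text \<open>\<open>T\<close> has as many elements as the graph has edges, so covering
  \<open>T\<close> makes the edge labelling bijective. An edge at the centre carries the label of
  its other end, whence \<open>f\<close> is injective on the neighbours of the centre; the remaining
  assumptions deal with the vertices \<open>y\<close>.\<close>

lemma vane_label_bij_betw:
  fixes T :: "nat set"
  assumes "card T = 3 * length ps + 4 * length qs" "0 \<notin> T" "T \<subseteq> {..N}"
    and cover: "T \<subseteq> (\<Union>(a, b)\<in>set ps. {a, b, b - a}) \<union> (\<Union>(x, y, z)\<in>set qs. {x, z, x - y, z - y})"
    and "distinct (map (\<lambda>(x, y, z). y) qs)"
    and "\<And>x y z a b. (x, y, z) \<in> set qs \<Longrightarrow> (a, b) \<in> set ps \<Longrightarrow> y \<noteq> a \<and> y \<noteq> b"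
    and "\<And>x y z x' y' z'. (x, y, z) \<in> set qs \<Longrightarrow> (x', y', z') \<in> set qs \<Longrightarrow> y \<noteq> x' \<and> y \<noteq> z'"
    and "\<And>x y z. (x, y, z) \<in> set qs \<Longrightarrow> 0 < y \<and> y \<le> N"
  defines "G \<equiv> C3C4_graph (length ps) (length qs)" and "f \<equiv> \<lambda>v. int (vane_label ps qs v)"
  shows "inj_on f (verts G) \<and> f ` verts G \<subseteq> {0..int N} \<and>
    (\<exists>g. induced_edge_labelling G f g \<and> bij_betw g (edges G) (int ` T))"
proof -
  define t where "t = length ps"
  define s where "s = length qs"
  define c :: "bouquet_vertex + bouquet_vertex" where "c = Inl Center"
  \<comment> \<open>\<open>M\<close> collects the vertices opposite the centre, \<open>A\<close> its
    neighbours.\<close>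
  define M :: "(bouquet_vertex + bouquet_vertex) set" where "M = (\<lambda>i. Inr (Rim i 2)) ` {..<s}"
  define A :: "(bouquet_vertex + bouquet_vertex) set" where
    "A = (\<Union>i<t. {Inl (Rim i 1), Inl (Rim i 2)}) \<union> (\<Union>i<s. {Inr (Rim i 1), Inr (Rim i 3)})"
  have verts: "verts G = insert c (A \<union> M)"
    unfolding G_def verts_C3C4_graph A_def M_def c_def t_def s_def by auto
  \<comment> \<open>Maximum minus minimum is the absolute difference, expressed without ordering the
    two ends.\<close>
  define g where "g = (\<lambda>e. Max (f ` e) - Min (f ` e))"
  have g: "g {v, w} = \<bar>f v - f w\<bar>" for v w
    by (simp add: g_def max_def min_def)
  have fc: "f c = 0" by (simp add: f_def c_def vane_label_def)
  have adj: "{v, c} \<in> edges G" if "v \<in> A" for v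
    using that unfolding A_def c_def G_def edges_C3C4_graph t_def s_def by blast
  have tri: "{Inl (Rim i 1), Inl (Rim i 2)} \<in> edges G" if "i < t" for i
    using that unfolding G_def edges_C3C4_graph t_def s_def by blast
  have sq: "{Inr (Rim i 1), Inr (Rim i 2)} \<in> edges G" "{Inr (Rim i 2), Inr (Rim i 3)} \<in> edges G"
    if "i < s" for i
    using that unfolding G_def edges_C3C4_graph t_def s_def by blast+
  have gA: "g {v, c} = f v" for v
    unfolding g fc by (simp add: f_def)
  have "int ` T \<subseteq> g ` edges G"
  proof
    fix k assume "k \<in> int ` T"
    then obtain l where l: "l \<in> T" "k = int l" by blast
    \<comment> \<open>A nonzero label cannot stem from a truncated subtraction, so it is a genuine
      difference.\<close>
    then have "l \<noteq> 0" using assms(2) by metis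
    from l(1) cover consider a b where "(a, b) \<in> set ps" "l \<in> {a, b, b - a}"
      | x y z where "(x, y, z) \<in> set qs" "l \<in> {x, z, x - y, z - y}" by blast
    then show "k \<in> g ` edges G"
    proof cases
      case (1 a b)
      then obtain i where i: "i < t" "ps ! i = (a, b)" by (metis in_set_conv_nth t_def)
      have f: "f (Inl (Rim i 1)) = a" "f (Inl (Rim i 2)) = b"
        using i by (simp_all add: f_def vane_label_def)
      have "Inl (Rim i 1) \<in> A" "Inl (Rim i 2) \<in> A" using i by (auto simp: A_def)
      then have "g {Inl (Rim i 1), c} \<in> g ` edges G" "g {Inl (Rim i 2), c} \<in> g ` edges G"
        "g {Inl (Rim i 1), Inl (Rim i 2)} \<in> g ` edges G"
        using adj tri i(1) by blast+
      then show ?thesis using 1(2) \<open>l \<noteq> 0\<close> unfolding gA unfolding g f l(2)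
        by (auto simp: of_nat_diff)
    next
      case (2 x y z)
      then obtain i where i: "i < s" "qs ! i = (x, y, z)" by (metis in_set_conv_nth s_def)
      have f: "f (Inr (Rim i 1)) = x" "f (Inr (Rim i 2)) = y" "f (Inr (Rim i 3)) = z"
        using i by (simp_all add: f_def vane_label_def)
      have "Inr (Rim i 1) \<in> A" "Inr (Rim i 3) \<in> A" using i by (auto simp: A_def)
      then have "g {Inr (Rim i 1), c} \<in> g ` edges G" "g {Inr (Rim i 3), c} \<in> g ` edges G"
        "g {Inr (Rim i 1), Inr (Rim i 2)} \<in> g ` edges G"
        "g {Inr (Rim i 2), Inr (Rim i 3)} \<in> g ` edges G"
        using adj sq i(1) by blast+
      then show ?thesis using 2(2) \<open>l \<noteq> 0\<close> unfolding gA unfolding g f l(2)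
        by (auto simp: of_nat_diff abs_minus_commute)
    qed
  qed
  moreover have card: "card (edges G) = card (int ` T)"
    by (simp add: G_def card_edges_C3C4_graph assms(1) card_image)
  moreover have fin: "finite (edges G)"
    unfolding G_def edges_C3C4_graph by simp
  \<comment> \<open>The image contains \<open>T\<close> and has at most \<open>card T\<close>
    elements, so it equals \<open>T\<close>; equal cardinalities then make \<open>g\<close>
    injective.\<close>
  ultimately have img: "g ` edges G = int ` T"
    by (metis card_image_le card_seteq finite_imageI)
  then have inj: "inj_on g (edges G)"
    using card fin by (simp add: eq_card_imp_inj_on)
  have fA: "f v \<in> int ` T" if "v \<in> A" for v
    using adj[OF that] img gA[of v] by (metis imageI)
  have "inj_on f A"
  proof
    fix v w assume vw: "v \<in> A" "w \<in> A" "f v = f w"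
    then have "{v, c} = {w, c}" using inj adj gA by (metis inj_onD)
    then show "v = w" by (metis doubleton_eq_iff)
  qed
  moreover have "inj_on f M"
    using assms(5) unfolding M_def f_def
    by (auto simp: inj_on_def vane_label_def distinct_conv_nth s_def split_beta)
  moreover have "f ` A \<inter> f ` M = {}"
  proof -
    have "f v \<noteq> f w" if vw: "v \<in> A" "w \<in> M" for v w
    proof -
      obtain j where j: "j < s" "w = Inr (Rim j 2)" using vw(2) unfolding M_def by blast
      obtain x y z where q: "qs ! j = (x, y, z)" by (metis prod_cases3)
      then have q': "(x, y, z) \<in> set qs" using j(1) by (metis nth_mem s_def)
      have "f w = y" using j q by (simp add: f_def vane_label_def)
      moreover have "f v \<noteq> int y"
      proof -
        consider i where "i < t" "v = Inl (Rim i 1) \<or> v = Inl (Rim i 2)"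
          | i where "i < s" "v = Inr (Rim i 1) \<or> v = Inr (Rim i 3)"
          using vw(1) unfolding A_def by blast
        then show ?thesis
        proof cases
          case (1 i)
          obtain a b where p: "ps ! i = (a, b)" by (metis surj_pair)
          then have "(a, b) \<in> set ps" using 1(1) by (metis nth_mem t_def)
          then show ?thesis using assms(6)[OF q', of a b] p 1(2) by (auto simp: f_def vane_label_def)
        next
          case (2 i)
          obtain x' y' z' where p: "qs ! i = (x', y', z')" by (metis prod_cases3)
          then have "(x', y', z') \<in> set qs" using 2(1) by (metis nth_mem s_def)
          then show ?thesis using assms(7)[OF q', of x' y' z'] p 2(2) by (auto simp: f_def vane_label_def)
        qed
      qed
      ultimately show ?thesis by simp
    qed
    then show ?thesis by blast
  qed
  moreover have fM: "0 < f w \<and> f w \<le> int N" if w: "w \<in> M" for w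
  proof -
    obtain j where j: "j < s" "w = Inr (Rim j 2)" using w unfolding M_def by blast
    obtain x y z where q: "qs ! j = (x, y, z)" by (metis prod_cases3)
    then have "(x, y, z) \<in> set qs" using j(1) by (metis nth_mem s_def)
    from assms(8)[OF this] show ?thesis using j q by (simp add: f_def vane_label_def)
  qed
  moreover have fA': "0 < f v \<and> f v \<le> int N" if "v \<in> A" for v
    using fA[OF that] assms(2,3) by (auto simp: gr0_conv_Suc) (metis not0_implies_Suc)
  ultimately have "inj_on f (insert c (A \<union> M))"
    by (fastforce simp: inj_on_Un inj_on_insert fc)
  moreover have "f ` insert c (A \<union> M) \<subseteq> {0..int N}"
    using fM fA' by (fastforce simp: fc)
  moreover have "induced_edge_labelling G f g"
    by (simp add: induced_edge_labelling_def g)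
  ultimately show ?thesis
    unfolding verts using inj img by (auto simp: bij_betw_def)
qed

text \<open>The differences of the pairs supply \<open>1..t\<close>, the squares
  \<open>t + 1..t + 4 * s\<close>, and the shifted entries of the pairs the rest. \<open>e\<close>
  is the excess of the largest permitted label over the number of edges: 0 for Skolem, 1 for hooked
  sequences.\<close>

lemma ex_vane_labelling:
  assumes ps: "skolem_pairs t P ps" and qs: "length qs = s" "square_vanes t qs"
    and P: "card P = 2 * t" "0 \<notin> P" "P \<subseteq> {..2 * t + e}"
  shows "\<exists>f. inj_on f (verts (C3C4_graph t s)) \<and>
    f ` verts (C3C4_graph t s) \<subseteq> {0..int (3 * t + 4 * s + e)} \<and>
    (\<exists>g. induced_edge_labelling (C3C4_graph t s) f g \<and>
      bij_betw g (edges (C3C4_graph t s)) (int ` ({1..t + 4 * s} \<union> (+) (t + 4 * s) ` P)))"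
proof -
  define w where "w = t + 4 * s"
  \<comment> \<open>The shift preserves the differences and lifts the triangle vertices above all
    labels of the squares.\<close>
  define rs where "rs = map (\<lambda>(a, b). (w + a, w + b)) ps"
  define T where "T = {1..w} \<union> (+) w ` P"
  have len: "length rs = t" using ps by (simp add: rs_def skolem_pairs_def)
  have "finite P" using P(3) finite_subset by blast
  then have "card T = w + 2 * t"
    unfolding T_def using P(1,2)
    by (subst card_Un_disjoint) (auto simp: card_image)
  then have card: "card T = 3 * length rs + 4 * length qs"
    using len qs(1) by (simp add: w_def)
  have T: "0 \<notin> T" "T \<subseteq> {..w + 2 * t + e}" using P(2,3) by (auto simp: T_def w_def)
  have mem: "(w + a, w + b) \<in> set rs" if "(a, b) \<in> set ps" for a b
    using that by (force simp: rs_def)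
  have d: "{1..t} \<subseteq> (\<Union>(a, b)\<in>set rs. {a, b, b - a})"
  proof
    fix d assume "d \<in> {1..t}"
    then have "d \<in> (\<lambda>(a, b). b - a) ` set ps" using ps unfolding skolem_pairs_def by (meson subsetD)
    then obtain a b where ab: "(a, b) \<in> set ps" "d = b - a" by auto
    show "d \<in> (\<Union>(a, b)\<in>set rs. {a, b, b - a})"
      by (rule UN_I[OF mem[OF ab(1)]]) (simp add: ab(2))
  qed
  have p: "(+) w ` P \<subseteq> (\<Union>(a, b)\<in>set rs. {a, b, b - a})"
  proof
    fix v assume "v \<in> (+) w ` P"
    then obtain v' where v': "v' \<in> P" "v = w + v'" by blast
    have "v' \<in> fst ` set ps \<union> snd ` set ps"
      using v'(1) ps unfolding skolem_pairs_def by (meson subsetD)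
    then obtain a b where ab: "(a, b) \<in> set ps" "v' = a \<or> v' = b" by auto
    show "v \<in> (\<Union>(a, b)\<in>set rs. {a, b, b - a})"
      by (rule UN_I[OF mem[OF ab(1)]]) (use ab(2) v'(2) in auto)
  qed
  have q: "{t<..w} \<subseteq> (\<Union>(x, y, z)\<in>set qs. {x, z, x - y, z - y})"
    using qs(2) unfolding square_vanes_def qs(1) w_def by (elim conjE)
  have w: "{1..w} = {1..t} \<union> {t<..w}" by (auto simp: w_def)
  have cover: "T \<subseteq> (\<Union>(a, b)\<in>set rs. {a, b, b - a}) \<union>
      (\<Union>(x, y, z)\<in>set qs. {x, z, x - y, z - y})"
    unfolding T_def w by (intro Un_least le_supI1[OF d] le_supI2[OF q] le_supI1[OF p])
  have rs: "w < a" "w < b" if "(a, b) \<in> set rs" for a b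
    using that ps unfolding skolem_pairs_def rs_def by force+
  note y = square_vanesD[OF qs(2), unfolded qs(1), folded w_def]
  note lab = vane_label_bij_betw[OF card T cover]
  have "inj_on (\<lambda>v. int (vane_label rs qs v)) (verts (C3C4_graph (length rs) (length qs))) \<and>
    (\<lambda>v. int (vane_label rs qs v)) ` verts (C3C4_graph (length rs) (length qs))
      \<subseteq> {0..int (w + 2 * t + e)} \<and>
    (\<exists>g. induced_edge_labelling (C3C4_graph (length rs) (length qs))
        (\<lambda>v. int (vane_label rs qs v)) g \<and>
      bij_betw g (edges (C3C4_graph (length rs) (length qs))) (int ` T))"
  proof (rule lab)
    show "distinct (map (\<lambda>(x, y, z). y) qs)" using qs(2) by (simp add: square_vanes_def)
  next
    fix x y z a b assume "(x, y, z) \<in> set qs" "(a, b) \<in> set rs"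
    then show "y \<noteq> a \<and> y \<noteq> b" using y(6)[of x y z] rs[of a b] by auto
  next
    fix x y z x' y' z' assume "(x, y, z) \<in> set qs" "(x', y', z') \<in> set qs"
    then show "y \<noteq> x' \<and> y \<noteq> z'" by (simp add: square_vanes_middle_neq[OF qs(2)])
  next
    fix x y z assume "(x, y, z) \<in> set qs"
    then show "0 < y \<and> y \<le> w + 2 * t + e" using y(5,6)[of x y z] by simp
  qed
  then show ?thesis
    unfolding len qs(1) T_def w_def
    by (intro exI[of _ "\<lambda>v. int (vane_label rs qs v)"]) (simp add: algebra_simps)
qed

theorem theorem4p2:
  fixes t s :: nat
  assumes "4 \<le> t" and "t \<le> s" and "real s \<le> (13 * real t + 37) / 2"
  shows "(t mod 4 = 0 \<or> t mod 4 = 1 \<longrightarrow> graceful (C3C4_graph t s)) \<and>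
         (t mod 4 = 2 \<or> t mod 4 = 3 \<longrightarrow> near_graceful (C3C4_graph t s))"
proof (intro conjI impI)
  have "real (2 * s) \<le> real (13 * t + 37)" using assms(3) by simp
  then have "2 * s \<le> 13 * t + 37" by (simp only: of_nat_le_iff)
  then obtain qs where qs: "length qs = s" "square_vanes t qs"
    using ex_square_vanes[of t s] assms(1,2) by auto
  {
    assume "t mod 4 = 0 \<or> t mod 4 = 1"
    from ex_skolem_pairs[OF assms(1) this] obtain ps where ps: "skolem_pairs t {1..2 * t} ps" ..
    have "{1..t + 4 * s} \<union> (+) (t + 4 * s) ` {1..2 * t} = {1..3 * t + 4 * s}"
      unfolding image_add_atLeastAtMost by auto
    then have "int ` ({1..t + 4 * s} \<union> (+) (t + 4 * s) ` {1..2 * t}) = {1..int (3 * t + 4 * s)}"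
      by (simp add: image_int_atLeastAtMost)
    then show "graceful (C3C4_graph t s)"
      using ex_vane_labelling[OF ps qs, of 0]
      unfolding graceful_def graceful_labelling_def Let_def card_edges_C3C4_graph by simp
  }
  {
    let ?P = "{1..2 * t - 1} \<union> {2 * t + 1}" and ?m = "int (3 * t + 4 * s)"
    assume "t mod 4 = 2 \<or> t mod 4 = 3"
    from ex_hooked_skolem_pairs[OF assms(1) this] obtain ps where ps: "skolem_pairs t ?P ps" ..
    have "card ?P = 2 * t" using assms(1) by (subst card_Un_disjoint) auto
    moreover have "0 \<notin> ?P" "?P \<subseteq> {..2 * t + 1}" by auto
    ultimately obtain f g where fg: "inj_on f (verts (C3C4_graph t s))"
      "f ` verts (C3C4_graph t s) \<subseteq> {0..int (3 * t + 4 * s + 1)}"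
      "induced_edge_labelling (C3C4_graph t s) f g"
      "bij_betw g (edges (C3C4_graph t s)) (int ` ({1..t + 4 * s} \<union> (+) (t + 4 * s) ` ?P))"
      using ex_vane_labelling[OF ps qs, of 1] by blast
    \<comment> \<open>The shift turns the missing \<open>2 * t\<close> into the number of edges and
      the hook into its successor, which is the second alternative for a near graceful
      labelling.\<close>
    have "{1..t + 4 * s} \<union> (+) (t + 4 * s) ` ?P = {1..3 * t + 4 * s - 1} \<union> {3 * t + 4 * s + 1}"
      unfolding image_Un image_add_atLeastAtMost using assms(1) by auto
    then have img: "int ` ({1..t + 4 * s} \<union> (+) (t + 4 * s) ` ?P) = {1..?m - 1} \<union> {?m + 1}"
      using assms(1) by (simp only: image_Un image_int_atLeastAtMost) (simp add: of_nat_diff add.commute)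
    have "bij_betw g (edges (C3C4_graph t s)) ({1..?m - 1} \<union> {?m + 1})"
      using fg(4) unfolding img .
    moreover have "f ` verts (C3C4_graph t s) \<subseteq> {0..?m + 1}"
      using fg(2) by (simp add: add.commute)
    ultimately show "near_graceful (C3C4_graph t s)"
      unfolding near_graceful_def near_graceful_labelling_def Let_def card_edges_C3C4_graph
      using fg(1,3) by blast
  }
qed

end
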